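(* Let $\mathsf{v2u}$ be the Cedille term of type $\forall A{:}\star.\ \forall n{:}\mathsf{Nat}.\ \mathsf{Vec}\cdot A\ n\to\mathsf{VecL}\cdot A\ n$, coercing inductive vectors to length-constrained lists, defined in the context. Then its erasure is the identity function: $|\mathsf{v2u}| =_{\alpha\beta\eta}\lambda x.\,x$.
   Context: **Terms and erasure.** Terms are those of Cedille (type theory $\iota\lambda P2$), a type-annotated Curry-style dependent type theory. $\star$ is the kind of types; $\lambda x.\,t$ and $t\ t'$ are explicit abstraction and application (types $\Pi x{:}T.\,T'$, or $T\to T'$); $\Lambda x.\,t$ is implicit (erased) abstraction over a value or a type (types $\forall x{:}T.\,T'$, or $T\Rightarrow T'$ if non-dependent), with implicit value application $t\ {-}t'$ and type application $t\cdot T$; $[t,t']$, $t.1$, $t.2$ are the introduction and projections of the dependent intersection type $\iota x{:}T.\,T'$; $\beta$ and $\beta\{t\}$ are reflexivity proofs of the heterogeneous equality type $t_1\simeq t_2$; $\rho\ q - t$ is $t$ with its type rewritten by the equality proof $q$; $\varsigma\ q$ is symmetry of $q$. Erasure $|\cdot|$ maps annotated terms to untyped $\lambda$-terms: $|x|=x$, $|\lambda x.t|=\lambda x.|t|$, $|t\ t'|=|t|\ |t'|$, $|\Lambda x.t|=|t|$, $|t\ {-}t'|=|t|$, $|t\cdot T|=|t|$, $|[t,t']|=|t|$, $|t.1|=|t.2|=|t|$, $|\beta\{t\}|=|t|$, $|\beta|=\lambda x.x$, $|\rho\ q - t|=|t|$. Defined constants are unfolded. Erased terms are compared up to $\alpha\beta\eta$-equality.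 Type information does not affect erasure. **Lists.** $\mathsf{ListC}\cdot A=\forall X{:}\star.\ X\to(A\to X\to X)\to X$; $\mathsf{nilCL}=\Lambda A,X.\lambda c_N,c_C.\,c_N$; $\mathsf{consCL}=\Lambda A.\lambda x,xs.\Lambda X.\lambda c_N,c_C.\ c_C\ x\ (xs\cdot X\ c_N\ c_C)$; $\mathsf{ListP}\cdot A\ xsC=\forall X{:}\star.\forall P{:}X\to\star.\forall c_N{:}X.\forall c_C{:}A\to X\to X.\ P\ c_N\to(\forall xs{:}X.\Pi x{:}A.\ P\ xs\to P(c_C\ x\ xs))\to P(xsC\cdot X\ c_N\ c_C)$; $\mathsf{ListR}\cdot A\ xsC=(xsC\cdot(\mathsf{ListC}\cdot A)\ \mathsf{nilCL}\ \mathsf{consCL}\simeq xsC)$; $\mathsf{List}\cdot A=\iota xs{:}(\iota xsC{:}\mathsf{ListC}\cdot A.\ \mathsf{ListP}\cdot A\ xsC).\ \mathsf{ListR}\cdot A\ xs.1$. Helper: $\mathsf{mkList}=\Lambda A.\lambda xs.\Lambda q.\,[xs,\ \rho\ q-\beta\{xs\}]$ of type $\forall A.\Pi xs{:}(\iota xsC{:}\mathsf{ListC}\cdot A.\mathsf{ListP}\cdot A\ xsC).\ \mathsf{ListR}\cdot A\ xs.1\Rightarrow\mathsf{List}\cdot A$. $\mathsf{length}:\forall A{:}\star.\mathsf{List}\cdot A\to\mathsf{Nat}$ is the usual length function. **Vectors.** $\mathsf{Nat}$ is the type of naturals with $\mathsf{zero},\mathsf{suc}$. $\mathsf{VecC}\cdot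 A\ n=\forall X{:}\mathsf{Nat}\to\star.\ X\ \mathsf{zero}\to(\forall n{:}\mathsf{Nat}.\ A\to X\ n\to X(\mathsf{suc}\ n))\to X\ n$; $\mathsf{nilCV}=\Lambda A,X.\lambda c_N,c_C.\,c_N$; $\mathsf{consCV}=\Lambda A,n.\lambda x,xs.\Lambda X.\lambda c_N,c_C.\ c_C\ {-}n\ x\ (xs\cdot X\ c_N\ c_C)$; $\mathsf{VecP}\cdot A\ n\ xsC=\forall X{:}\mathsf{Nat}\to\star.\forall P{:}\Pi n{:}\mathsf{Nat}.X\ n\to\star.\forall c_N{:}X\ \mathsf{zero}.\forall c_C{:}(\forall n{:}\mathsf{Nat}.A\to X\ n\to X(\mathsf{suc}\ n)).\ P\ \mathsf{zero}\ c_N\to(\forall n{:}\mathsf{Nat}.\forall xs{:}X\ n.\Pi x{:}A.\ P\ n\ xs\to P(\mathsf{suc}\ n)(c_C\ {-}n\ x\ xs))\to P\ n\ (xsC\cdot X\ c_N\ c_C)$; $\mathsf{VecR}\cdot A\ n\ xsC=(xsC\cdot(\mathsf{VecC}\cdot A)\ \mathsf{nilCV}\ \mathsf{consCV}\simeq xsC)$; $\mathsf{Vec}\cdot A\ n=\iota xs{:}(\iota xsC{:}\mathsf{VecC}\cdot A\ n.\ \mathsf{VecP}\cdot A\ n\ xsC).\ \mathsf{VecR}\cdot A\ n\ xs.1$. **Coercion $\mathsf{v2l}$** of type $\forall A.\forall n.\ \mathsf{Vec}\cdot A\ n\to\mathsf{List}\cdot A$. $\mathsf{v2lC}=\Lambda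 A.\Lambda n.\lambda xs.\Lambda X.\lambda c_N.\lambda c_C.\ xs.1.1\cdot(\lambda\_{:}\mathsf{Nat}.X)\ c_N\ (\Lambda\_.\,c_C)$; $\mathsf{v2lP}=\Lambda A.\Lambda n.\lambda xs.\Lambda X.\Lambda P.\Lambda c_N.\Lambda c_C.\lambda p_N.\lambda p_C.\ xs.1.2\cdot(\lambda\_{:}\mathsf{Nat}.X)\cdot(\lambda\_{:}\mathsf{Nat}.P)\ {-}c_N\ {-}(\Lambda\_.\,c_C)\ p_N\ (\Lambda\_.\,p_C)$; $\mathsf{v2lR}=\Lambda A.\Lambda n.\lambda xs.\ xs.2$; $\mathsf{v2l}=\Lambda A.\Lambda n.\lambda xs.\ \mathsf{mkList}\cdot A\ [\mathsf{v2lC}\cdot A\ {-}n\ xs,\ \mathsf{v2lP}\cdot A\ {-}n\ xs]\ {-}(\mathsf{v2lR}\cdot A\ {-}n\ xs)$. **Length-constrained lists.** $\mathsf{VecL}\cdot A\ n=\iota xs{:}\mathsf{List}\cdot A.\ (n\simeq\mathsf{length}\cdot A\ xs)$. $\mathsf{mkVecL}:\forall A.\forall n.\Pi xs{:}\mathsf{List}\cdot A.\ (\mathsf{length}\cdot A\ xs\simeq n)\Rightarrow\mathsf{VecL}\cdot A\ n$ is $\Lambda A.\Lambda n.\lambda xs.\Lambda q.\,[xs,\ \rho\ q-\beta\{xs\}]$. $\mathsf{lengthPres}$ is a proof of $\forall A.\forall n.\Pi xs{:}\mathsf{Vec}\cdot A\ n.\ n\simeq\mathsf{length}\cdot A\ (\mathsf{v2l}\cdot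 A\ {-}n\ xs)$. $\mathsf{v2u}=\Lambda A.\Lambda n.\lambda xs.\ \mathsf{mkVecL}\cdot A\ {-}n\ (\mathsf{v2l}\cdot A\ {-}n\ xs)\ {-}(\varsigma\ (\mathsf{lengthPres}\cdot A\ {-}n\ xs))$. *)

theory Defs
  imports Main
begin

section \<open>Untyped lambda terms up to alpha-beta-eta\<close>

type_synonym name = string

datatype lam = LVar name | LLam name lam | LApp lam lam

primrec fv :: "lam \<Rightarrow> name set" where
  "fv (LVar x) = {x}"
| "fv (LLam x t) = fv t - {x}"
| "fv (LApp t u) = fv t \<union> fv u"

text \<open>Textual substitution \<open>t[x := s]\<close>. It does not rename bound variables, so it is only used
  under the side condition \<open>free_for s x t\<close>, which excludes variable capture.\<close>

primrec lsubst :: "name \<Rightarrow> lam \<Rightarrow> lam \<Rightarrow> lam" where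
  "lsubst x s (LVar y) = (if y = x then s else LVar y)"
| "lsubst x s (LLam y t) = LLam y (if y = x then t else lsubst x s t)"
| "lsubst x s (LApp t u) = LApp (lsubst x s t) (lsubst x s u)"

primrec free_for :: "lam \<Rightarrow> name \<Rightarrow> lam \<Rightarrow> bool" where
  "free_for s x (LVar y) \<longleftrightarrow> True"
| "free_for s x (LLam y t) \<longleftrightarrow> x \<notin> fv (LLam y t) \<or> (y \<notin> fv s \<and> free_for s x t)"
| "free_for s x (LApp t u) \<longleftrightarrow> free_for s x t \<and> free_for s x u"

text \<open>The side condition of \<open>beta\<close> is no restriction, since \<open>alpha\<close> can always be used first to
  rename the bound variables of \<open>t\<close>.\<close>

inductive abe_eq :: "lam \<Rightarrow> lam \<Rightarrow> bool" (infix "=\<^sub>\<alpha>\<^sub>\<beta>\<^sub>\<eta>" 50) where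
  refl: "t =\<^sub>\<alpha>\<^sub>\<beta>\<^sub>\<eta> t"
| sym: "t =\<^sub>\<alpha>\<^sub>\<beta>\<^sub>\<eta> u \<Longrightarrow> u =\<^sub>\<alpha>\<^sub>\<beta>\<^sub>\<eta> t"
| trans: "t =\<^sub>\<alpha>\<^sub>\<beta>\<^sub>\<eta> u \<Longrightarrow> u =\<^sub>\<alpha>\<^sub>\<beta>\<^sub>\<eta> v \<Longrightarrow> t =\<^sub>\<alpha>\<^sub>\<beta>\<^sub>\<eta> v"
| lam: "t =\<^sub>\<alpha>\<^sub>\<beta>\<^sub>\<eta> t' \<Longrightarrow> LLam x t =\<^sub>\<alpha>\<^sub>\<beta>\<^sub>\<eta> LLam x t'"
| app: "t =\<^sub>\<alpha>\<^sub>\<beta>\<^sub>\<eta> t' \<Longrightarrow> u =\<^sub>\<alpha>\<^sub>\<beta>\<^sub>\<eta> u' \<Longrightarrow> LApp t u =\<^sub>\<alpha>\<^sub>\<beta>\<^sub>\<eta> LApp t' u'"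
| alpha: "y \<notin> fv t \<Longrightarrow> free_for (LVar y) x t \<Longrightarrow> LLam x t =\<^sub>\<alpha>\<^sub>\<beta>\<^sub>\<eta> LLam y (lsubst x (LVar y) t)"
| beta: "free_for s x t \<Longrightarrow> LApp (LLam x t) s =\<^sub>\<alpha>\<^sub>\<beta>\<^sub>\<eta> lsubst x s t"
| eta: "x \<notin> fv t \<Longrightarrow> LLam x (LApp t (LVar x)) =\<^sub>\<alpha>\<^sub>\<beta>\<^sub>\<eta> t"


section \<open>Cedille kinds, types and annotated terms\<close>

text \<open>
  Type formers come in pairs, over a value (classified by a type) and over a type (classified by
  a kind, bold star in the notation).  In terms, \<open>ILam\<close> abstracts over a value or a type.
  \<open>Defn T t\<close> is an occurrence of a constant that has been defined by \<open>t\<close> with declared type \<open>T\<close>.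
  Defined types have
  no such constructor: they are type expressions, so using one is unfolding it.
\<close>

datatype kd =
    Star ("\<^bold>\<star>")
  | KPi name ty kd
  | KPiK name kd kd
and ty =
    TVar name
  | TPi name ty ty ("(\<^bold>\<Pi>_\<^bold>:_\<^bold>. _)" [1000, 55, 50] 50)
  | TAll name ty ty ("(\<^bold>\<forall>_\<^bold>:_\<^bold>. _)" [1000, 55, 50] 50)
  | TAllK name kd ty ("(\<^bold>\<forall>_\<^bold>:\<^bold>:_\<^bold>. _)" [1000, 55, 50] 50)
  | TIota name ty ty ("(\<^bold>\<iota>_\<^bold>:_\<^bold>. _)" [1000, 55, 50] 50)
  | TEq tm tm (infix "\<^bold>\<simeq>" 60)
  | TLam name ty ty ("(\<^bold>\<lambda>_\<^bold>:_\<^bold>. _)" [1000, 55, 50] 50)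
  | TLamK name kd ty ("(\<^bold>\<lambda>_\<^bold>:\<^bold>:_\<^bold>. _)" [1000, 55, 50] 50)
  | TApp ty ty (infixl "\<^bold>\<bullet>" 80)
  | TAppTm ty tm (infixl "\<^bold>\<circ>" 80)
and tm =
    Var name
  | Lam name tm ("(\<^bold>\<lambda>_\<^bold>. _)" [1000, 50] 50)
  | App tm tm (infixl "\<^bold>$" 80)
  | ILam name tm ("(\<^bold>\<Lambda>_\<^bold>. _)" [1000, 50] 50)
  | IApp tm tm (infixl "\<^bold>-" 80)
  | TyApp tm ty (infixl "\<^bold>\<cdot>" 80)
  | Pair tm tm ("\<^bold>[_\<^bold>, _\<^bold>]")
  | Proj1 tm ("_\<^bold>.\<^bold>1" [1000] 1000)
  | Proj2 tm ("_\<^bold>.\<^bold>2" [1000] 1000)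
  | Beta ("\<^bold>\<beta>")
  | BetaT tm ("\<^bold>\<beta>\<^bold>{_\<^bold>}")
  | Rho tm tm ("(\<^bold>\<rho> _ \<^bold>\<midarrow> _)" [81, 70] 70)
  | Sym tm ("(\<^bold>\<sigma> _)" [81] 80)
  | Defn ty tm

abbreviation KArr :: "ty \<Rightarrow> kd \<Rightarrow> kd" (infixr "\<^bold>\<rightarrow>\<^bold>\<star>" 55) where
  "T \<^bold>\<rightarrow>\<^bold>\<star> k \<equiv> KPi ''_'' T k"

abbreviation Arr :: "ty \<Rightarrow> ty \<Rightarrow> ty" (infixr "\<^bold>\<rightarrow>" 55) where
  "T \<^bold>\<rightarrow> T' \<equiv> TPi ''_'' T T'"

abbreviation IArr :: "ty \<Rightarrow> ty \<Rightarrow> ty" (infixr "\<^bold>\<Rightarrow>" 55) where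
  "T \<^bold>\<Rightarrow> T' \<equiv> TAll ''_'' T T'"

text \<open>Equality proofs by symmetry carry the evidence of the given proof, hence the last but one
  clause.\<close>

primrec erase :: "tm \<Rightarrow> lam" where
  "erase (Var x) = LVar x"
| "erase (Lam x t) = LLam x (erase t)"
| "erase (App t t') = LApp (erase t) (erase t')"
| "erase (ILam x t) = erase t"
| "erase (IApp t t') = erase t"
| "erase (TyApp t T) = erase t"
| "erase (Pair t t') = erase t"
| "erase (Proj1 t) = erase t"
| "erase (Proj2 t) = erase t"
| "erase Beta = LLam ''x'' (LVar ''x'')"
| "erase (BetaT t) = erase t"
| "erase (Rho q t) = erase t"
| "erase (Sym q) = erase q"
| "erase (Defn T t) = erase t"


section \<open>Lists\<close>

abbreviation "vA \<equiv> TVar ''A''"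
abbreviation "vX \<equiv> TVar ''X''"
abbreviation "vP \<equiv> TVar ''P''"
abbreviation "vn \<equiv> Var ''n''"
abbreviation "vx \<equiv> Var ''x''"
abbreviation "vxs \<equiv> Var ''xs''"
abbreviation "vxsC \<equiv> Var ''xsC''"
abbreviation "vcN \<equiv> Var ''cN''"
abbreviation "vcC \<equiv> Var ''cC''"
abbreviation "vpN \<equiv> Var ''pN''"
abbreviation "vpC \<equiv> Var ''pC''"
abbreviation "vq \<equiv> Var ''q''"

definition ListC :: ty where
  "ListC = (\<^bold>\<lambda>''A''\<^bold>:\<^bold>:\<^bold>\<star>\<^bold>. \<^bold>\<forall>''X''\<^bold>:\<^bold>:\<^bold>\<star>\<^bold>. vX \<^bold>\<rightarrow> (vA \<^bold>\<rightarrow> vX \<^bold>\<rightarrow> vX) \<^bold>\<rightarrow> vX)"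

definition nilCL :: tm where
  "nilCL = Defn (\<^bold>\<forall>''A''\<^bold>:\<^bold>:\<^bold>\<star>\<^bold>. ListC \<^bold>\<bullet> vA)
    (\<^bold>\<Lambda>''A''\<^bold>. \<^bold>\<Lambda>''X''\<^bold>. \<^bold>\<lambda>''cN''\<^bold>. \<^bold>\<lambda>''cC''\<^bold>. vcN)"

definition consCL :: tm where
  "consCL = Defn (\<^bold>\<forall>''A''\<^bold>:\<^bold>:\<^bold>\<star>\<^bold>. vA \<^bold>\<rightarrow> ListC \<^bold>\<bullet> vA \<^bold>\<rightarrow> ListC \<^bold>\<bullet> vA)
    (\<^bold>\<Lambda>''A''\<^bold>. \<^bold>\<lambda>''x''\<^bold>. \<^bold>\<lambda>''xs''\<^bold>. \<^bold>\<Lambda>''X''\<^bold>. \<^bold>\<lambda>''cN''\<^bold>. \<^bold>\<lambda>''cC''\<^bold>.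
      vcC \<^bold>$ vx \<^bold>$ (vxs \<^bold>\<cdot> vX \<^bold>$ vcN \<^bold>$ vcC))"

definition ListP :: ty where
  "ListP = (\<^bold>\<lambda>''A''\<^bold>:\<^bold>:\<^bold>\<star>\<^bold>. \<^bold>\<lambda>''xsC''\<^bold>:ListC \<^bold>\<bullet> vA\<^bold>.
    \<^bold>\<forall>''X''\<^bold>:\<^bold>:\<^bold>\<star>\<^bold>. \<^bold>\<forall>''P''\<^bold>:\<^bold>:vX \<^bold>\<rightarrow>\<^bold>\<star> \<^bold>\<star>\<^bold>. \<^bold>\<forall>''cN''\<^bold>:vX\<^bold>. \<^bold>\<forall>''cC''\<^bold>:vA \<^bold>\<rightarrow> vX \<^bold>\<rightarrow> vX\<^bold>.
      vP \<^bold>\<circ> vcN \<^bold>\<rightarrow>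
      (\<^bold>\<forall>''xs''\<^bold>:vX\<^bold>. \<^bold>\<Pi>''x''\<^bold>:vA\<^bold>. vP \<^bold>\<circ> vxs \<^bold>\<rightarrow> vP \<^bold>\<circ> (vcC \<^bold>$ vx \<^bold>$ vxs)) \<^bold>\<rightarrow>
      vP \<^bold>\<circ> (vxsC \<^bold>\<cdot> vX \<^bold>$ vcN \<^bold>$ vcC))"

definition ListR :: ty where
  "ListR = (\<^bold>\<lambda>''A''\<^bold>:\<^bold>:\<^bold>\<star>\<^bold>. \<^bold>\<lambda>''xsC''\<^bold>:ListC \<^bold>\<bullet> vA\<^bold>.
    (vxsC \<^bold>\<cdot> (ListC \<^bold>\<bullet> vA) \<^bold>$ nilCL \<^bold>$ consCL) \<^bold>\<simeq> vxsC)"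

definition List :: ty where
  "List = (\<^bold>\<lambda>''A''\<^bold>:\<^bold>:\<^bold>\<star>\<^bold>.
    \<^bold>\<iota>''xs''\<^bold>:(\<^bold>\<iota>''xsC''\<^bold>:ListC \<^bold>\<bullet> vA\<^bold>. ListP \<^bold>\<bullet> vA \<^bold>\<circ> vxsC)\<^bold>. ListR \<^bold>\<bullet> vA \<^bold>\<circ> vxs\<^bold>.\<^bold>1)"

definition mkList :: tm where
  "mkList = Defn
    (\<^bold>\<forall>''A''\<^bold>:\<^bold>:\<^bold>\<star>\<^bold>. \<^bold>\<Pi>''xs''\<^bold>:(\<^bold>\<iota>''xsC''\<^bold>:ListC \<^bold>\<bullet> vA\<^bold>. ListP \<^bold>\<bullet> vA \<^bold>\<circ> vxsC)\<^bold>.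
      ListR \<^bold>\<bullet> vA \<^bold>\<circ> vxs\<^bold>.\<^bold>1 \<^bold>\<Rightarrow> List \<^bold>\<bullet> vA)
    (\<^bold>\<Lambda>''A''\<^bold>. \<^bold>\<lambda>''xs''\<^bold>. \<^bold>\<Lambda>''q''\<^bold>. \<^bold>[vxs\<^bold>, \<^bold>\<rho> vq \<^bold>\<midarrow> \<^bold>\<beta>\<^bold>{vxs\<^bold>}\<^bold>])"


section \<open>Vectors\<close>

text \<open>The type of naturals and its constructors are left abstract; so are, below, the length
  function on lists (\<open>len\<close>) and the proof that \<open>v2l\<close> preserves length (\<open>lp\<close>).\<close>

record nats =
  NatT :: ty
  zero_body :: tm
  suc_body :: tm

definition zeroN :: "nats \<Rightarrow> tm" where
  "zeroN N = Defn (NatT N) (zero_body N)"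

definition sucN :: "nats \<Rightarrow> tm" where
  "sucN N = Defn (NatT N \<^bold>\<rightarrow> NatT N) (suc_body N)"

definition VecC :: "nats \<Rightarrow> ty" where
  "VecC N = (\<^bold>\<lambda>''A''\<^bold>:\<^bold>:\<^bold>\<star>\<^bold>. \<^bold>\<lambda>''n''\<^bold>:NatT N\<^bold>.
    \<^bold>\<forall>''X''\<^bold>:\<^bold>:NatT N \<^bold>\<rightarrow>\<^bold>\<star> \<^bold>\<star>\<^bold>.
      vX \<^bold>\<circ> zeroN N \<^bold>\<rightarrow> (\<^bold>\<forall>''n''\<^bold>:NatT N\<^bold>. vA \<^bold>\<rightarrow> vX \<^bold>\<circ> vn \<^bold>\<rightarrow> vX \<^bold>\<circ> (sucN N \<^bold>$ vn)) \<^bold>\<rightarrow> vX \<^bold>\<circ> vn)"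

definition nilCV :: "nats \<Rightarrow> tm" where
  "nilCV N = Defn (\<^bold>\<forall>''A''\<^bold>:\<^bold>:\<^bold>\<star>\<^bold>. VecC N \<^bold>\<bullet> vA \<^bold>\<circ> zeroN N)
    (\<^bold>\<Lambda>''A''\<^bold>. \<^bold>\<Lambda>''X''\<^bold>. \<^bold>\<lambda>''cN''\<^bold>. \<^bold>\<lambda>''cC''\<^bold>. vcN)"

definition consCV :: "nats \<Rightarrow> tm" where
  "consCV N = Defn
    (\<^bold>\<forall>''A''\<^bold>:\<^bold>:\<^bold>\<star>\<^bold>. \<^bold>\<forall>''n''\<^bold>:NatT N\<^bold>. vA \<^bold>\<rightarrow> VecC N \<^bold>\<bullet> vA \<^bold>\<circ> vn \<^bold>\<rightarrow> VecC N \<^bold>\<bullet> vA \<^bold>\<circ> (sucN N \<^bold>$ vn))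
    (\<^bold>\<Lambda>''A''\<^bold>. \<^bold>\<Lambda>''n''\<^bold>. \<^bold>\<lambda>''x''\<^bold>. \<^bold>\<lambda>''xs''\<^bold>. \<^bold>\<Lambda>''X''\<^bold>. \<^bold>\<lambda>''cN''\<^bold>. \<^bold>\<lambda>''cC''\<^bold>.
      vcC \<^bold>- vn \<^bold>$ vx \<^bold>$ (vxs \<^bold>\<cdot> vX \<^bold>$ vcN \<^bold>$ vcC))"

definition VecP :: "nats \<Rightarrow> ty" where
  "VecP N = (\<^bold>\<lambda>''A''\<^bold>:\<^bold>:\<^bold>\<star>\<^bold>. \<^bold>\<lambda>''n''\<^bold>:NatT N\<^bold>. \<^bold>\<lambda>''xsC''\<^bold>:VecC N \<^bold>\<bullet> vA \<^bold>\<circ> vn\<^bold>.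
    \<^bold>\<forall>''X''\<^bold>:\<^bold>:NatT N \<^bold>\<rightarrow>\<^bold>\<star> \<^bold>\<star>\<^bold>.
    \<^bold>\<forall>''P''\<^bold>:\<^bold>:KPi ''n'' (NatT N) (vX \<^bold>\<circ> vn \<^bold>\<rightarrow>\<^bold>\<star> \<^bold>\<star>)\<^bold>.
    \<^bold>\<forall>''cN''\<^bold>:vX \<^bold>\<circ> zeroN N\<^bold>.
    \<^bold>\<forall>''cC''\<^bold>:(\<^bold>\<forall>''n''\<^bold>:NatT N\<^bold>. vA \<^bold>\<rightarrow> vX \<^bold>\<circ> vn \<^bold>\<rightarrow> vX \<^bold>\<circ> (sucN N \<^bold>$ vn))\<^bold>.
      vP \<^bold>\<circ> zeroN N \<^bold>\<circ> vcN \<^bold>\<rightarrow>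
      (\<^bold>\<forall>''n''\<^bold>:NatT N\<^bold>. \<^bold>\<forall>''xs''\<^bold>:vX \<^bold>\<circ> vn\<^bold>. \<^bold>\<Pi>''x''\<^bold>:vA\<^bold>.
        vP \<^bold>\<circ> vn \<^bold>\<circ> vxs \<^bold>\<rightarrow> vP \<^bold>\<circ> (sucN N \<^bold>$ vn) \<^bold>\<circ> (vcC \<^bold>- vn \<^bold>$ vx \<^bold>$ vxs)) \<^bold>\<rightarrow>
      vP \<^bold>\<circ> vn \<^bold>\<circ> (vxsC \<^bold>\<cdot> vX \<^bold>$ vcN \<^bold>$ vcC))"

definition VecR :: "nats \<Rightarrow> ty" where
  "VecR N = (\<^bold>\<lambda>''A''\<^bold>:\<^bold>:\<^bold>\<star>\<^bold>. \<^bold>\<lambda>''n''\<^bold>:NatT N\<^bold>. \<^bold>\<lambda>''xsC''\<^bold>:VecC N \<^bold>\<bullet> vA \<^bold>\<circ> vn\<^bold>.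
    (vxsC \<^bold>\<cdot> (VecC N \<^bold>\<bullet> vA) \<^bold>$ nilCV N \<^bold>$ consCV N) \<^bold>\<simeq> vxsC)"

definition Vec :: "nats \<Rightarrow> ty" where
  "Vec N = (\<^bold>\<lambda>''A''\<^bold>:\<^bold>:\<^bold>\<star>\<^bold>. \<^bold>\<lambda>''n''\<^bold>:NatT N\<^bold>.
    \<^bold>\<iota>''xs''\<^bold>:(\<^bold>\<iota>''xsC''\<^bold>:VecC N \<^bold>\<bullet> vA \<^bold>\<circ> vn\<^bold>. VecP N \<^bold>\<bullet> vA \<^bold>\<circ> vn \<^bold>\<circ> vxsC)\<^bold>. VecR N \<^bold>\<bullet> vA \<^bold>\<circ> vn \<^bold>\<circ> vxs\<^bold>.\<^bold>1)"


section \<open>The coercion from vectors to lists\<close>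

definition v2lC :: "nats \<Rightarrow> tm" where
  "v2lC N = Defn
    (\<^bold>\<forall>''A''\<^bold>:\<^bold>:\<^bold>\<star>\<^bold>. \<^bold>\<forall>''n''\<^bold>:NatT N\<^bold>. Vec N \<^bold>\<bullet> vA \<^bold>\<circ> vn \<^bold>\<rightarrow> ListC \<^bold>\<bullet> vA)
    (\<^bold>\<Lambda>''A''\<^bold>. \<^bold>\<Lambda>''n''\<^bold>. \<^bold>\<lambda>''xs''\<^bold>. \<^bold>\<Lambda>''X''\<^bold>. \<^bold>\<lambda>''cN''\<^bold>. \<^bold>\<lambda>''cC''\<^bold>.
      vxs\<^bold>.\<^bold>1\<^bold>.\<^bold>1 \<^bold>\<cdot> (\<^bold>\<lambda>''_''\<^bold>:NatT N\<^bold>. vX) \<^bold>$ vcN \<^bold>$ (\<^bold>\<Lambda>''_''\<^bold>. vcC))"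

definition v2lP :: "nats \<Rightarrow> tm" where
  "v2lP N = Defn
    (\<^bold>\<forall>''A''\<^bold>:\<^bold>:\<^bold>\<star>\<^bold>. \<^bold>\<forall>''n''\<^bold>:NatT N\<^bold>. \<^bold>\<Pi>''xs''\<^bold>:Vec N \<^bold>\<bullet> vA \<^bold>\<circ> vn\<^bold>.
      ListP \<^bold>\<bullet> vA \<^bold>\<circ> (v2lC N \<^bold>\<cdot> vA \<^bold>- vn \<^bold>$ vxs))
    (\<^bold>\<Lambda>''A''\<^bold>. \<^bold>\<Lambda>''n''\<^bold>. \<^bold>\<lambda>''xs''\<^bold>. \<^bold>\<Lambda>''X''\<^bold>. \<^bold>\<Lambda>''P''\<^bold>. \<^bold>\<Lambda>''cN''\<^bold>. \<^bold>\<Lambda>''cC''\<^bold>.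
      \<^bold>\<lambda>''pN''\<^bold>. \<^bold>\<lambda>''pC''\<^bold>.
      vxs\<^bold>.\<^bold>1\<^bold>.\<^bold>2 \<^bold>\<cdot> (\<^bold>\<lambda>''_''\<^bold>:NatT N\<^bold>. vX) \<^bold>\<cdot> (\<^bold>\<lambda>''_''\<^bold>:NatT N\<^bold>. vP) \<^bold>- vcN \<^bold>- (\<^bold>\<Lambda>''_''\<^bold>. vcC)
        \<^bold>$ vpN \<^bold>$ (\<^bold>\<Lambda>''_''\<^bold>. vpC))"

definition v2lR :: "nats \<Rightarrow> tm" where
  "v2lR N = Defn
    (\<^bold>\<forall>''A''\<^bold>:\<^bold>:\<^bold>\<star>\<^bold>. \<^bold>\<forall>''n''\<^bold>:NatT N\<^bold>. \<^bold>\<Pi>''xs''\<^bold>:Vec N \<^bold>\<bullet> vA \<^bold>\<circ> vn\<^bold>.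
      ListR \<^bold>\<bullet> vA \<^bold>\<circ> (v2lC N \<^bold>\<cdot> vA \<^bold>- vn \<^bold>$ vxs))
    (\<^bold>\<Lambda>''A''\<^bold>. \<^bold>\<Lambda>''n''\<^bold>. \<^bold>\<lambda>''xs''\<^bold>. vxs\<^bold>.\<^bold>2)"

definition v2l :: "nats \<Rightarrow> tm" where
  "v2l N = Defn
    (\<^bold>\<forall>''A''\<^bold>:\<^bold>:\<^bold>\<star>\<^bold>. \<^bold>\<forall>''n''\<^bold>:NatT N\<^bold>. Vec N \<^bold>\<bullet> vA \<^bold>\<circ> vn \<^bold>\<rightarrow> List \<^bold>\<bullet> vA)
    (\<^bold>\<Lambda>''A''\<^bold>. \<^bold>\<Lambda>''n''\<^bold>. \<^bold>\<lambda>''xs''\<^bold>.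
      mkList \<^bold>\<cdot> vA \<^bold>$ \<^bold>[v2lC N \<^bold>\<cdot> vA \<^bold>- vn \<^bold>$ vxs\<^bold>, v2lP N \<^bold>\<cdot> vA \<^bold>- vn \<^bold>$ vxs\<^bold>]
        \<^bold>- (v2lR N \<^bold>\<cdot> vA \<^bold>- vn \<^bold>$ vxs))"


section \<open>The coercion from vectors to length-constrained lists\<close>

definition lengthL :: "nats \<Rightarrow> tm \<Rightarrow> tm" where
  "lengthL N len = Defn (\<^bold>\<forall>''A''\<^bold>:\<^bold>:\<^bold>\<star>\<^bold>. List \<^bold>\<bullet> vA \<^bold>\<rightarrow> NatT N) len"

definition VecL :: "nats \<Rightarrow> tm \<Rightarrow> ty" where
  "VecL N len = (\<^bold>\<lambda>''A''\<^bold>:\<^bold>:\<^bold>\<star>\<^bold>. \<^bold>\<lambda>''n''\<^bold>:NatT N\<^bold>.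
    \<^bold>\<iota>''xs''\<^bold>:List \<^bold>\<bullet> vA\<^bold>. vn \<^bold>\<simeq> (lengthL N len \<^bold>\<cdot> vA \<^bold>$ vxs))"

definition mkVecL :: "nats \<Rightarrow> tm \<Rightarrow> tm" where
  "mkVecL N len = Defn
    (\<^bold>\<forall>''A''\<^bold>:\<^bold>:\<^bold>\<star>\<^bold>. \<^bold>\<forall>''n''\<^bold>:NatT N\<^bold>. \<^bold>\<Pi>''xs''\<^bold>:List \<^bold>\<bullet> vA\<^bold>.
      (lengthL N len \<^bold>\<cdot> vA \<^bold>$ vxs) \<^bold>\<simeq> vn \<^bold>\<Rightarrow> VecL N len \<^bold>\<bullet> vA \<^bold>\<circ> vn)
    (\<^bold>\<Lambda>''A''\<^bold>. \<^bold>\<Lambda>''n''\<^bold>. \<^bold>\<lambda>''xs''\<^bold>. \<^bold>\<Lambda>''q''\<^bold>. \<^bold>[vxs\<^bold>, \<^bold>\<rho> vq \<^bold>\<midarrow> \<^bold>\<beta>\<^bold>{vxs\<^bold>}\<^bold>])"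

definition lengthPres :: "nats \<Rightarrow> tm \<Rightarrow> tm \<Rightarrow> tm" where
  "lengthPres N len lp = Defn
    (\<^bold>\<forall>''A''\<^bold>:\<^bold>:\<^bold>\<star>\<^bold>. \<^bold>\<forall>''n''\<^bold>:NatT N\<^bold>. \<^bold>\<Pi>''xs''\<^bold>:Vec N \<^bold>\<bullet> vA \<^bold>\<circ> vn\<^bold>.
      vn \<^bold>\<simeq> (lengthL N len \<^bold>\<cdot> vA \<^bold>$ (v2l N \<^bold>\<cdot> vA \<^bold>- vn \<^bold>$ vxs)))
    lp"

definition v2u :: "nats \<Rightarrow> tm \<Rightarrow> tm \<Rightarrow> tm" where
  "v2u N len lp = Defn
    (\<^bold>\<forall>''A''\<^bold>:\<^bold>:\<^bold>\<star>\<^bold>. \<^bold>\<forall>''n''\<^bold>:NatT N\<^bold>. Vec N \<^bold>\<bullet> vA \<^bold>\<circ> vn \<^bold>\<rightarrow> VecL N len \<^bold>\<bullet> vA \<^bold>\<circ> vn)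
    (\<^bold>\<Lambda>''A''\<^bold>. \<^bold>\<Lambda>''n''\<^bold>. \<^bold>\<lambda>''xs''\<^bold>.
      mkVecL N len \<^bold>\<cdot> vA \<^bold>- vn \<^bold>$ (v2l N \<^bold>\<cdot> vA \<^bold>- vn \<^bold>$ vxs)
        \<^bold>- (\<^bold>\<sigma> (lengthPres N len lp \<^bold>\<cdot> vA \<^bold>- vn \<^bold>$ vxs)))"

end

theory Submission
  imports Defs
begin

text \<open>Erasure keeps only explicit abstractions and applications, and of a pair only its first
  component. So \<open>v2lC\<close> erases to a double eta-expansion of the identity, while
  \<open>mkList\<close> and \<open>mkVecL\<close> erase to the identity itself. Hence
  \<open>v2l\<close>, and then \<open>v2u\<close>, erase to a composite of identities, whatever
  \<open>N\<close>, \<open>len\<close> and \<open>lp\<close> are.\<close>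

abbreviation lid :: "name \<Rightarrow> lam" where
  "lid x \<equiv> LLam x (LVar x)"

lemma lid_app: "LApp (lid x) t =\<^sub>\<alpha>\<^sub>\<beta>\<^sub>\<eta> t"
  using abe_eq.beta[of t x "LVar x"] by simp

lemma app_eq_of_eq_lid:
  assumes "f =\<^sub>\<alpha>\<^sub>\<beta>\<^sub>\<eta> lid x"
  shows "LApp f t =\<^sub>\<alpha>\<^sub>\<beta>\<^sub>\<eta> t"
  using abe_eq.app[OF assms abe_eq.refl] lid_app by (rule abe_eq.trans)

lemma lid_rename: "lid x =\<^sub>\<alpha>\<^sub>\<beta>\<^sub>\<eta> lid y"
proof (cases "x = y")
  case True
  then show ?thesis by (simp add: abe_eq.refl)
next
  case False
  then show ?thesis using abe_eq.alpha[of y "LVar x" x] by simp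
qed

text \<open>The common shape of the erased \<open>v2l\<close> and \<open>v2u\<close>:
  \<open>lid z\<close> is the erased \<open>mkList\<close> or \<open>mkVecL\<close>, and
  \<open>f\<close> is the erasure of the coercion fed to it.\<close>

lemma lid_comp_eq_lid:
  assumes "f =\<^sub>\<alpha>\<^sub>\<beta>\<^sub>\<eta> lid y"
  shows "LLam x (LApp (lid z) (LApp f (LVar x))) =\<^sub>\<alpha>\<^sub>\<beta>\<^sub>\<eta> lid x"
  by (rule abe_eq.lam, rule abe_eq.trans, rule lid_app, rule app_eq_of_eq_lid, rule assms)

text \<open>Two eta-contractions under the binder \<open>x\<close>, first \<open>z\<close>, then
  \<open>y\<close>; the distinctness assumptions are their freshness conditions.\<close>

lemma eta2_eq_lid:
  assumes "y \<noteq> x" and "z \<noteq> x" and "z \<noteq> y"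
  shows "LLam x (LLam y (LLam z (LApp (LApp (LVar x) (LVar y)) (LVar z)))) =\<^sub>\<alpha>\<^sub>\<beta>\<^sub>\<eta> lid x"
proof (rule abe_eq.lam)
  have "LLam z (LApp (LApp (LVar x) (LVar y)) (LVar z)) =\<^sub>\<alpha>\<^sub>\<beta>\<^sub>\<eta> LApp (LVar x) (LVar y)"
    by (rule abe_eq.eta) (simp add: assms)
  then have "LLam y (LLam z (LApp (LApp (LVar x) (LVar y)) (LVar z)))
      =\<^sub>\<alpha>\<^sub>\<beta>\<^sub>\<eta> LLam y (LApp (LVar x) (LVar y))"
    by (rule abe_eq.lam)
  moreover have "LLam y (LApp (LVar x) (LVar y)) =\<^sub>\<alpha>\<^sub>\<beta>\<^sub>\<eta> LVar x"
    by (rule abe_eq.eta) (simp add: assms)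
  ultimately show "LLam y (LLam z (LApp (LApp (LVar x) (LVar y)) (LVar z))) =\<^sub>\<alpha>\<^sub>\<beta>\<^sub>\<eta> LVar x"
    by (rule abe_eq.trans)
qed

lemma erase_v2lC: "erase (v2lC N) =\<^sub>\<alpha>\<^sub>\<beta>\<^sub>\<eta> lid ''xs''"
  unfolding v2lC_def erase.simps by (rule eta2_eq_lid) simp_all

text \<open>\<open>v2lP\<close> vanishes as a second component and \<open>v2lR\<close> as an
  implicit argument, so only \<open>v2lC\<close> matters.\<close>

lemma erase_v2l: "erase (v2l N) =\<^sub>\<alpha>\<^sub>\<beta>\<^sub>\<eta> lid ''xs''"
  unfolding v2l_def mkList_def erase.simps by (rule lid_comp_eq_lid[OF erase_v2lC])

theorem theorem4p2:
  fixes N :: nats and len lp :: tm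
  shows "erase (v2u N len lp) =\<^sub>\<alpha>\<^sub>\<beta>\<^sub>\<eta> LLam ''x'' (LVar ''x'')"
proof (rule abe_eq.trans)
  show "erase (v2u N len lp) =\<^sub>\<alpha>\<^sub>\<beta>\<^sub>\<eta> lid ''xs''"
    \<comment> \<open>The length proof is an implicit argument, so it is erased.\<close>
    unfolding v2u_def mkVecL_def erase.simps by (rule lid_comp_eq_lid[OF erase_v2l])
  show "lid ''xs'' =\<^sub>\<alpha>\<^sub>\<beta>\<^sub>\<eta> lid ''x''"
    by (rule lid_rename)
qed

end
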